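(* A structural abstract logic $\mathcal{S}$ in a propositional language $\mathcal{L}$ is uniform if, and only if, it is determined by a uniform bundle (equivalently, a uniform atlas) of $\mathcal{L}$-matrices, i.e. there is a uniform bundle $\mathcal{B}$ of $\mathcal{L}$-matrices with $\vdash_{\mathcal{S}}\,=\,\vdash_{\mathcal{B}}$.
   Context: $\mathcal{L}$ is an abstract propositional language, given by a set $\mathcal{V}_{\mathcal{L}}$ of variables, a set of constants and a set of finitary connectives. $\mathbf{Fm}_{\mathcal{L}}$ is the set of all $\mathcal{L}$-formulae; $\mathcal{V}(\alpha)$ is the set of variables occurring in $\alpha$, and $\mathcal{V}(X)=\bigcup_{\alpha\in X}\mathcal{V}(\alpha)$ for $X\subseteq\mathbf{Fm}_{\mathcal{L}}$. For $\mathcal{V}\subseteq\mathcal{V}_{\mathcal{L}}$, $\mathbf{Fm}_{\mathcal{L}}[\mathcal{V}]=\{\alpha\in\mathbf{Fm}_{\mathcal{L}} : \mathcal{V}(\alpha)\subseteq\mathcal{V}\}$. A structural abstract logic $\mathcal{S}$ is given by a (not necessarily finitary) consequence relation $\vdash_{\mathcal{S}}$ on $\mathbf{Fm}_{\mathcal{L}}$ (reflexive, monotone, transitive/closed under cut) closed under substitutions, equivalently by its consequence operator $\mathbf{Cn}_{\mathcal{S}}(X)=\{\alpha : X\vdash_{\mathcal{S}}\alpha\}$. $\mathcal{S}$ is uniform if for all $X,Y\subseteq\mathbf{Fm}_{\mathcal{L}}$ and $\alpha\in\mathbf{Fm}_{\mathcal{L}}$ such that $\mathcal{V}(X\cup\{\alpha\})\cap\mathcal{V}(Y)=\varnothing$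 and $Y$ is consistent (i.e. $\mathbf{Cn}_{\mathcal{S}}(Y)\neq\mathbf{Fm}_{\mathcal{L}}$): $X\cup Y\vdash_{\mathcal{S}}\alpha$ implies $X\vdash_{\mathcal{S}}\alpha$. An $\mathcal{L}$-matrix is a pair $\mathbf{M}=\langle\mathbf{A},D\rangle$ with $\mathbf{A}$ an algebra of the signature of $\mathcal{L}$ and $D\subseteq|\mathbf{A}|$ (its logical filter). $X\models_{\mathbf{M}}\alpha$ means: for every valuation $v$ in $\mathbf{A}$ (homomorphism from the formula algebra to $\mathbf{A}$), if $v[X]\subseteq D$ then $v[\alpha]\in D$. For a nonempty family $\mathcal{M}=\{\mathbf{M}_i\}_{i\in I}$, $X\vdash_{\mathcal{M}}\alpha$ iff $X\models_{\mathbf{M}_i}\alpha$ for each $i\in I$. A nonempty family of $\mathcal{L}$-matrices is a bundle if its algebras are pairwise isomorphic. An atlas is a pair $\langle\mathbf{A},\{D_i\}_{i\in I}\rangle$ with each $D_i\subseteq|\mathbf{A}|$; its corresponding bundle is $\{\langle\mathbf{A},D_i\rangle\}_{i\in I}$, and its consequence is that of the corresponding bundle. For an $\mathcal{L}$-matrix $\mathbf{M}=\langle\mathbf{A},D\rangle$, $\mathfrak{S}(\mathbf{M})$ is the set of all $X\subseteq\mathbf{Fm}_{\mathcal{L}}$ such that $X=\{\alpha\in\mathbf{Fm}_{\mathcal{L}} : v[\alpha]\in D\}$ for some valuation $v$ in $\mathbf{A}$. A bundle $\{\mathbf{M}_i\}_{i\in I}$ is uniform if for all $X,Y\subseteq\mathbf{Fm}_{\mathcal{L}}$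 with $X\subseteq\mathbf{Fm}_{\mathcal{L}}[\mathcal{V}_{\mathcal{L}}\setminus\mathcal{V}(Y)]$, all $i,j\in I$, all $Z_i\in\mathfrak{S}(\mathbf{M}_i)$ and $Z_j\in\mathfrak{S}(\mathbf{M}_j)$, there are $k\in I$ and $Z_k\in\mathfrak{S}(\mathbf{M}_k)$ such that: if $X\subseteq Z_i$ and $Y\subseteq Z_j\subsetneq\mathbf{Fm}_{\mathcal{L}}$, then $Z_i\cap\mathbf{Fm}_{\mathcal{L}}[\mathcal{V}_{\mathcal{L}}\setminus\mathcal{V}(Y)]=Z_k\cap\mathbf{Fm}_{\mathcal{L}}[\mathcal{V}_{\mathcal{L}}\setminus\mathcal{V}(Y)]$ and $Z_j\cap\mathbf{Fm}_{\mathcal{L}}[\mathcal{V}(Y)]\subseteq Z_k$. An atlas is uniform if its corresponding bundle is uniform. *)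

theory Defs imports Main begin

text \<open>
  Variables, constants and connectives are sets over arbitrary types rather than whole types,
  since HOL types are nonempty and a language may, for instance, have no constants.
\<close>

record ('v, 'c, 'f) language =
  variables :: "'v set"
  constants :: "'c set"
  connectives :: "'f set"
  arity :: "'f \<Rightarrow> nat"

text \<open>
  Raw formulae; \<open>fm_vars\<close> is the set of variables occurring in a formula.  The
  formulae of a given language are carved out by \<open>Fm\<close> below.
\<close>

datatype (fm_vars: 'v, fm_consts: 'c, fm_conns: 'f) fm =
    Var 'v
  | Const 'c
  | Conn 'f "('v, 'c, 'f) fm list"

inductive_set Fm :: "('v, 'c, 'f) language \<Rightarrow> ('v, 'c, 'f) fm set"
  for L :: "('v, 'c, 'f) language" where
  Var: "x \<in> variables L \<Longrightarrow> Var x \<in> Fm L"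
| Const: "c \<in> constants L \<Longrightarrow> Const c \<in> Fm L"
| Conn: "f \<in> connectives L \<Longrightarrow> length ts = arity L f \<Longrightarrow> (\<forall>t\<in>set ts. t \<in> Fm L)
    \<Longrightarrow> Conn f ts \<in> Fm L"

definition vars_of :: "('v, 'c, 'f) fm set \<Rightarrow> 'v set" where
  "vars_of X = (\<Union>\<alpha>\<in>X. fm_vars \<alpha>)"

definition Fm_over :: "('v, 'c, 'f) language \<Rightarrow> 'v set \<Rightarrow> ('v, 'c, 'f) fm set" where
  "Fm_over L V = {\<alpha> \<in> Fm L. fm_vars \<alpha> \<subseteq> V}"

text \<open>
  Operations of an algebra matter only on constants and connectives of the language, and on
  argument lists over the carrier of the right length.
\<close>

record ('a, 'c, 'f) algebra =
  carrier :: "'a set"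
  const_op :: "'c \<Rightarrow> 'a"
  conn_op :: "'f \<Rightarrow> 'a list \<Rightarrow> 'a"

definition is_algebra :: "('v, 'c, 'f) language \<Rightarrow> ('a, 'c, 'f) algebra \<Rightarrow> bool" where
  "is_algebra L A \<longleftrightarrow>
     carrier A \<noteq> {} \<and>
     (\<forall>c\<in>constants L. const_op A c \<in> carrier A) \<and>
     (\<forall>f\<in>connectives L. \<forall>as. length as = arity L f \<and> set as \<subseteq> carrier A
        \<longrightarrow> conn_op A f as \<in> carrier A)"

definition alg_hom ::
  "('v, 'c, 'f) language \<Rightarrow> ('a, 'c, 'f) algebra \<Rightarrow> ('b, 'c, 'f) algebra \<Rightarrow> ('a \<Rightarrow> 'b) set" where
  "alg_hom L A B = {h.
     (\<forall>a\<in>carrier A. h a \<in> carrier B) \<and>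
     (\<forall>c\<in>constants L. h (const_op A c) = const_op B c) \<and>
     (\<forall>f\<in>connectives L. \<forall>as. length as = arity L f \<and> set as \<subseteq> carrier A
        \<longrightarrow> h (conn_op A f as) = conn_op B f (map h as))}"

definition alg_isomorphic ::
  "('v, 'c, 'f) language \<Rightarrow> ('a, 'c, 'f) algebra \<Rightarrow> ('b, 'c, 'f) algebra \<Rightarrow> bool" where
  "alg_isomorphic L A B \<longleftrightarrow> (\<exists>h\<in>alg_hom L A B. bij_betw h (carrier A) (carrier B))"

definition fm_algebra :: "('v, 'c, 'f) language \<Rightarrow> (('v, 'c, 'f) fm, 'c, 'f) algebra" where
  "fm_algebra L = \<lparr>carrier = Fm L, const_op = Const, conn_op = Conn\<rparr>"

definition valuations ::
  "('v, 'c, 'f) language \<Rightarrow> ('a, 'c, 'f) algebra \<Rightarrow> (('v, 'c, 'f) fm \<Rightarrow> 'a) set" where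
  "valuations L A = alg_hom L (fm_algebra L) A"

definition substitutions ::
  "('v, 'c, 'f) language \<Rightarrow> (('v, 'c, 'f) fm \<Rightarrow> ('v, 'c, 'f) fm) set" where
  "substitutions L = alg_hom L (fm_algebra L) (fm_algebra L)"

text \<open>
  Every consequence relation below holds only between sets of formulae of the language and
  formulae of the language, so that two of them agree iff they are equal as HOL predicates.
\<close>

type_synonym ('v, 'c, 'f) conseq = "('v, 'c, 'f) fm set \<Rightarrow> ('v, 'c, 'f) fm \<Rightarrow> bool"

definition structural_logic :: "('v, 'c, 'f) language \<Rightarrow> ('v, 'c, 'f) conseq \<Rightarrow> bool" where
  "structural_logic L S \<longleftrightarrow>
     (\<forall>X \<alpha>. S X \<alpha> \<longrightarrow> X \<subseteq> Fm L \<and> \<alpha> \<in> Fm L) \<and>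
     (\<forall>X\<subseteq>Fm L. \<forall>\<alpha>\<in>X. S X \<alpha>) \<and>
     (\<forall>X\<subseteq>Fm L. \<forall>Y\<subseteq>Fm L. \<forall>\<alpha>\<in>Fm L. X \<subseteq> Y \<and> S X \<alpha> \<longrightarrow> S Y \<alpha>) \<and>
     (\<forall>X\<subseteq>Fm L. \<forall>Y\<subseteq>Fm L. \<forall>Z\<subseteq>Fm L. \<forall>\<alpha>\<in>Fm L.
        (\<forall>\<beta>\<in>Y. S X \<beta>) \<and> S (Y \<union> Z) \<alpha> \<longrightarrow> S (X \<union> Z) \<alpha>) \<and>
     (\<forall>\<sigma>\<in>substitutions L. \<forall>X\<subseteq>Fm L. \<forall>\<alpha>\<in>Fm L. S X \<alpha> \<longrightarrow> S (\<sigma> ` X) (\<sigma> \<alpha>))"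

definition Cn :: "('v, 'c, 'f) conseq \<Rightarrow> ('v, 'c, 'f) fm set \<Rightarrow> ('v, 'c, 'f) fm set" where
  "Cn S X = {\<alpha>. S X \<alpha>}"

definition consistent :: "('v, 'c, 'f) language \<Rightarrow> ('v, 'c, 'f) conseq \<Rightarrow> ('v, 'c, 'f) fm set \<Rightarrow> bool"
  where "consistent L S X \<longleftrightarrow> Cn S X \<noteq> Fm L"

definition uniform_logic :: "('v, 'c, 'f) language \<Rightarrow> ('v, 'c, 'f) conseq \<Rightarrow> bool" where
  "uniform_logic L S \<longleftrightarrow>
     (\<forall>X\<subseteq>Fm L. \<forall>Y\<subseteq>Fm L. \<forall>\<alpha>\<in>Fm L.
        vars_of (X \<union> {\<alpha>}) \<inter> vars_of Y = {} \<and> consistent L S Y \<longrightarrow>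
        S (X \<union> Y) \<alpha> \<longrightarrow> S X \<alpha>)"

type_synonym ('a, 'c, 'f) matrix = "('a, 'c, 'f) algebra \<times> 'a set"

definition is_matrix :: "('v, 'c, 'f) language \<Rightarrow> ('a, 'c, 'f) matrix \<Rightarrow> bool" where
  "is_matrix L M \<longleftrightarrow> is_algebra L (fst M) \<and> snd M \<subseteq> carrier (fst M)"

definition matrix_conseq ::
  "('v, 'c, 'f) language \<Rightarrow> ('a, 'c, 'f) matrix \<Rightarrow> ('v, 'c, 'f) conseq" where
  "matrix_conseq L M X \<alpha> \<longleftrightarrow> X \<subseteq> Fm L \<and> \<alpha> \<in> Fm L \<and>
     (\<forall>v\<in>valuations L (fst M). v ` X \<subseteq> snd M \<longrightarrow> v \<alpha> \<in> snd M)"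

text \<open>Families are indexed: \<open>M i\<close> is relevant only for \<open>i \<in> I\<close>.\<close>

definition family_conseq ::
  "('v, 'c, 'f) language \<Rightarrow> 'i set \<Rightarrow> ('i \<Rightarrow> ('a, 'c, 'f) matrix) \<Rightarrow> ('v, 'c, 'f) conseq" where
  "family_conseq L I M X \<alpha> \<longleftrightarrow> (\<forall>i\<in>I. matrix_conseq L (M i) X \<alpha>)"

definition matrix_bundle ::
  "('v, 'c, 'f) language \<Rightarrow> 'i set \<Rightarrow> ('i \<Rightarrow> ('a, 'c, 'f) matrix) \<Rightarrow> bool" where
  "matrix_bundle L I M \<longleftrightarrow> I \<noteq> {} \<and> (\<forall>i\<in>I. is_matrix L (M i)) \<and>
     (\<forall>i\<in>I. \<forall>j\<in>I. alg_isomorphic L (fst (M i)) (fst (M j)))"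

definition sat_sets ::
  "('v, 'c, 'f) language \<Rightarrow> ('a, 'c, 'f) matrix \<Rightarrow> ('v, 'c, 'f) fm set set" where
  "sat_sets L M = {X. \<exists>v\<in>valuations L (fst M). X = {\<alpha> \<in> Fm L. v \<alpha> \<in> snd M}}"

definition uniform_bundle ::
  "('v, 'c, 'f) language \<Rightarrow> 'i set \<Rightarrow> ('i \<Rightarrow> ('a, 'c, 'f) matrix) \<Rightarrow> bool" where
  "uniform_bundle L I M \<longleftrightarrow> matrix_bundle L I M \<and>
     (\<forall>X\<subseteq>Fm L. \<forall>Y\<subseteq>Fm L. X \<subseteq> Fm_over L (variables L - vars_of Y) \<longrightarrow>
       (\<forall>i\<in>I. \<forall>j\<in>I. \<forall>Zi\<in>sat_sets L (M i). \<forall>Zj\<in>sat_sets L (M j).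
         \<exists>k\<in>I. \<exists>Zk\<in>sat_sets L (M k).
           X \<subseteq> Zi \<and> Y \<subseteq> Zj \<and> Zj \<subset> Fm L \<longrightarrow>
             Zi \<inter> Fm_over L (variables L - vars_of Y)
               = Zk \<inter> Fm_over L (variables L - vars_of Y) \<and>
             Zj \<inter> Fm_over L (vars_of Y) \<subseteq> Zk))"

definition atlas ::
  "('v, 'c, 'f) language \<Rightarrow> ('a, 'c, 'f) algebra \<Rightarrow> 'i set \<Rightarrow> ('i \<Rightarrow> 'a set) \<Rightarrow> bool" where
  "atlas L A I D \<longleftrightarrow> is_algebra L A \<and> I \<noteq> {} \<and> (\<forall>i\<in>I. D i \<subseteq> carrier A)"

definition atlas_bundle ::
  "('a, 'c, 'f) algebra \<Rightarrow> ('i \<Rightarrow> 'a set) \<Rightarrow> 'i \<Rightarrow> ('a, 'c, 'f) matrix" where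
  "atlas_bundle A D = (\<lambda>i. (A, D i))"

definition uniform_atlas ::
  "('v, 'c, 'f) language \<Rightarrow> ('a, 'c, 'f) algebra \<Rightarrow> 'i set \<Rightarrow> ('i \<Rightarrow> 'a set) \<Rightarrow> bool" where
  "uniform_atlas L A I D \<longleftrightarrow> atlas L A I D \<and> uniform_bundle L I (atlas_bundle A D)"

definition atlas_conseq ::
  "('v, 'c, 'f) language \<Rightarrow> ('a, 'c, 'f) algebra \<Rightarrow> 'i set \<Rightarrow> ('i \<Rightarrow> 'a set) \<Rightarrow> ('v, 'c, 'f) conseq"
  where "atlas_conseq L A I D = family_conseq L I (atlas_bundle A D)"

text \<open>
  HOL cannot quantify existentially over types, so carrier and index types must be fixed where the
  existence of a uniform bundle or atlas is asserted.  Raw formulae (for carriers) and sets of raw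
  formulae (for indices) are used for this; that a logic determined by a uniform bundle or atlas is
  uniform is stated separately for arbitrary carrier and index types.
\<close>

end

theory Submission imports Defs begin

text \<open>
  If \<open>S\<close> is uniform, its Lindenbaum atlas, whose filters on the formula algebra are the theories
  of \<open>S\<close>, is uniform: all its satisfied sets are theories, and given theories \<open>Zi\<close> and \<open>Zj \<noteq> Fm\<close>,
  let \<open>Zk\<close> be the theory generated by the part of \<open>Zi\<close> avoiding the variables of \<open>Y\<close> and the part
  of \<open>Zj\<close> over the variables of \<open>Y\<close>; uniformity of \<open>S\<close> says exactly that \<open>Zk\<close> adds
  nothing to the former part.  Conversely, for a uniform bundle, a countermodel of \<open>X \<turnstile> \<alpha>\<close> and a proper
  model of \<open>Y\<close> amalgamate into a countermodel of \<open>X \<union> Y \<turnstile> \<alpha>\<close>.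
\<close>

definition theories :: "('v, 'c, 'f) language \<Rightarrow> ('v, 'c, 'f) conseq \<Rightarrow> ('v, 'c, 'f) fm set set" where
  "theories L S = {T. T \<subseteq> Fm L \<and> Cn S T = T}"

lemma fm_vars_subset_variables: "\<alpha> \<in> Fm L \<Longrightarrow> fm_vars \<alpha> \<subseteq> variables L"
  by (induction rule: Fm.induct) auto

lemma alg_isomorphic_refl: "alg_isomorphic L A A"
  unfolding alg_isomorphic_def alg_hom_def
  by (rule bexI[of _ "\<lambda>x. x"]) (auto simp: bij_betw_def)

lemma matrix_bundle_atlas: "atlas L A I D \<Longrightarrow> matrix_bundle L I (atlas_bundle A D)"
  by (simp add: atlas_def matrix_bundle_def atlas_bundle_def is_matrix_def alg_isomorphic_refl)

lemma is_algebra_fm_algebra: "Fm L \<noteq> {} \<Longrightarrow> is_algebra L (fm_algebra L)"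
  by (simp add: is_algebra_def fm_algebra_def Fm.Const Fm.Conn subset_iff)

lemma valuations_fm_algebra: "valuations L (fm_algebra L) = substitutions L"
  by (simp add: valuations_def substitutions_def)

lemma id_substitution: "(\<lambda>\<alpha>. \<alpha>) \<in> substitutions L"
  by (simp add: substitutions_def alg_hom_def)

section \<open>Consequence and theories of a fixed structural logic\<close>

context
  fixes L :: "('v, 'c, 'f) language" and S :: "('v, 'c, 'f) conseq"
  assumes logic: "structural_logic L S"
begin

lemmas logic_unfolded = logic[unfolded structural_logic_def]

lemma conseq_in_Fm: "S X \<alpha> \<Longrightarrow> X \<subseteq> Fm L \<and> \<alpha> \<in> Fm L"
  by (rule logic_unfolded[THEN conjunct1, rule_format])

lemma conseq_refl: "X \<subseteq> Fm L \<Longrightarrow> \<alpha> \<in> X \<Longrightarrow> S X \<alpha>"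
  by (rule logic_unfolded[THEN conjunct2, THEN conjunct1, rule_format])

lemma conseq_mono: "S X \<alpha> \<Longrightarrow> X \<subseteq> Y \<Longrightarrow> Y \<subseteq> Fm L \<Longrightarrow> S Y \<alpha>"
  using logic_unfolded[THEN conjunct2, THEN conjunct2, THEN conjunct1, rule_format, of X Y \<alpha>]
    conseq_in_Fm[of X \<alpha>] by simp

lemma conseq_trans:
  assumes X: "X \<subseteq> Fm L" and XY: "\<And>\<beta>. \<beta> \<in> Y \<Longrightarrow> S X \<beta>" and Y: "S Y \<alpha>"
  shows "S X \<alpha>"
  using logic_unfolded[THEN conjunct2, THEN conjunct2, THEN conjunct2, THEN conjunct1,
      rule_format, of X Y "{}" \<alpha>] X XY Y conseq_in_Fm[OF Y] by simp

lemma conseq_subst: "\<sigma> \<in> substitutions L \<Longrightarrow> S X \<alpha> \<Longrightarrow> S (\<sigma> ` X) (\<sigma> \<alpha>)"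
  using logic_unfolded[THEN conjunct2, THEN conjunct2, THEN conjunct2, THEN conjunct2,
      rule_format, of \<sigma> X \<alpha>] conseq_in_Fm[of X \<alpha>] by simp

lemma theories_iff: "T \<in> theories L S \<longleftrightarrow> T \<subseteq> Fm L \<and> (\<forall>\<alpha>. S T \<alpha> \<longrightarrow> \<alpha> \<in> T)"
  by (auto simp: theories_def Cn_def intro: conseq_refl)

lemma subset_Cn: "X \<subseteq> Fm L \<Longrightarrow> X \<subseteq> Cn S X"
  by (auto simp: Cn_def intro: conseq_refl)

lemma Cn_in_theories:
  assumes "X \<subseteq> Fm L"
  shows "Cn S X \<in> theories L S"
proof -
  have "S X \<alpha>" if "S (Cn S X) \<alpha>" for \<alpha>
    using conseq_trans[OF assms _ that] by (simp add: Cn_def)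
  then show ?thesis using conseq_in_Fm by (auto simp: theories_iff Cn_def)
qed

lemma theory_closed: "T \<in> theories L S \<Longrightarrow> S X \<alpha> \<Longrightarrow> X \<subseteq> T \<Longrightarrow> \<alpha> \<in> T"
  using conseq_mono[of X \<alpha> T] by (simp add: theories_iff)

text \<open>Structurality makes this work: if the preimage proves \<alpha>, then its image under
  \<sigma> proves \<open>\<sigma> \<alpha>\<close> and lies in \<open>T\<close>, which is closed
  under \<open>S\<close>.\<close>

lemma theory_vimage:
  assumes "\<sigma> \<in> substitutions L" "T \<in> theories L S"
  shows "{\<alpha> \<in> Fm L. \<sigma> \<alpha> \<in> T} \<in> theories L S"
proof -
  have "\<sigma> \<alpha> \<in> T" if "S {\<alpha> \<in> Fm L. \<sigma> \<alpha> \<in> T} \<alpha>" for \<alpha>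
    using theory_closed[OF assms(2) conseq_subst[OF assms(1) that]] by blast
  then show ?thesis unfolding theories_iff using conseq_in_Fm by blast
qed

section \<open>The Lindenbaum atlas and its satisfied sets\<close>

lemma sat_sets_fm_algebra:
  "T \<in> theories L S \<Longrightarrow> sat_sets L (fm_algebra L, T) \<subseteq> theories L S"
  unfolding sat_sets_def by (auto simp: valuations_fm_algebra theory_vimage)

text \<open>The identity substitution is the valuation. With the preceding inclusion, the satisfied
  sets of the whole Lindenbaum atlas are exactly the theories.\<close>

lemma theory_in_sat_sets: "T \<in> theories L S \<Longrightarrow> T \<in> sat_sets L (fm_algebra L, T)"
  using id_substitution[of L]
  by (auto simp: sat_sets_def valuations_fm_algebra theories_iff intro!: bexI[of _ "\<lambda>\<alpha>. \<alpha>"])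

lemma lindenbaum_atlas:
  assumes "Fm L \<noteq> {}"
  shows "atlas L (fm_algebra L) (theories L S) (\<lambda>T. T)"
proof -
  have "theories L S \<noteq> {}" using Cn_in_theories[of "{}"] by blast
  then show ?thesis
    using is_algebra_fm_algebra[OF assms] by (simp add: atlas_def fm_algebra_def theories_iff)
qed

text \<open>Soundness is structurality plus closure of theories. Completeness tests one matrix only,
  with filter \<open>Cn S X\<close>, under the identity substitution.\<close>

lemma lindenbaum_conseq: "S = atlas_conseq L (fm_algebra L) (theories L S) (\<lambda>T. T)"
proof (intro ext iffI)
  fix X \<alpha>
  assume S: "S X \<alpha>"
  have "\<sigma> \<alpha> \<in> T" if "T \<in> theories L S" "\<sigma> \<in> substitutions L" "\<sigma> ` X \<subseteq> T" for T \<sigma>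
    using theory_closed conseq_subst S that by blast
  then show "atlas_conseq L (fm_algebra L) (theories L S) (\<lambda>T. T) X \<alpha>"
    using conseq_in_Fm[OF S]
    by (simp add: atlas_conseq_def family_conseq_def atlas_bundle_def matrix_conseq_def
        valuations_fm_algebra)
next
  fix X \<alpha>
  assume "atlas_conseq L (fm_algebra L) (theories L S) (\<lambda>T. T) X \<alpha>"
  then have all: "\<And>T. T \<in> theories L S \<Longrightarrow> X \<subseteq> Fm L \<and> \<alpha> \<in> Fm L \<and>
      (\<forall>\<sigma>\<in>substitutions L. \<sigma> ` X \<subseteq> T \<longrightarrow> \<sigma> \<alpha> \<in> T)"
    by (simp add: atlas_conseq_def family_conseq_def atlas_bundle_def matrix_conseq_def
        valuations_fm_algebra)
  \<comment> \<open>\<open>all\<close> says something only once a theory is at hand;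
    \<open>Cn S {}\<close> supplies one.\<close>
  have X: "X \<subseteq> Fm L" using all Cn_in_theories[of "{}"] by blast
  have "\<alpha> \<in> Cn S X"
    using all[OF Cn_in_theories[OF X]] id_substitution subset_Cn[OF X] by force
  then show "S X \<alpha>" by (simp add: Cn_def)
qed

text \<open>Stated for any set \<open>V\<close> of variables, later \<open>vars_of Y\<close>. The
  two halves generating \<open>W\<close> share no variable, so uniformity lets the \<open>U\<close>
  half be dropped from a derivation of any formula avoiding \<open>V\<close>.\<close>

lemma theories_amalgamate:
  fixes V :: "'v set"
  assumes uniform: "uniform_logic L S"
    and T: "T \<in> theories L S" and U: "U \<in> theories L S" "U \<subset> Fm L"
  defines "W \<equiv> Cn S (T \<inter> Fm_over L (variables L - V) \<union> U \<inter> Fm_over L V)"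
  shows "W \<in> theories L S"
    and "T \<inter> Fm_over L (variables L - V) = W \<inter> Fm_over L (variables L - V)"
    and "U \<inter> Fm_over L V \<subseteq> W"
proof -
  let ?T = "T \<inter> Fm_over L (variables L - V)" and ?U = "U \<inter> Fm_over L V"
  have sub: "?T \<subseteq> Fm L" "?U \<subseteq> Fm L" by (auto simp: Fm_over_def)
  then show "W \<in> theories L S" unfolding W_def by (intro Cn_in_theories) blast
  have gen: "?T \<union> ?U \<subseteq> W" unfolding W_def using sub by (intro subset_Cn) blast
  then show "?U \<subseteq> W" by blast
  \<comment> \<open>Properness of \<open>U\<close> enters here: the consequences of its half stay
    inside the closed set \<open>U\<close>, hence do not exhaust \<open>Fm L\<close>.\<close>
  have "Cn S ?U \<subseteq> U" unfolding Cn_def using theory_closed[OF U(1)] by blast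
  then have cons: "consistent L S ?U" unfolding consistent_def using U(2) by blast
  \<comment> \<open>This is the only inclusion that rests on uniformity; the converse is part of
    \<open>gen\<close>.\<close>
  have "\<alpha> \<in> T" if "\<alpha> \<in> W" "\<alpha> \<in> Fm_over L (variables L - V)" for \<alpha>
  proof -
    have S: "S (?T \<union> ?U) \<alpha>" using that(1) by (simp add: W_def Cn_def)
    have "vars_of (?T \<union> {\<alpha>}) \<inter> vars_of ?U = {}"
      using that(2) by (auto simp: vars_of_def Fm_over_def)
    then have "S ?T \<alpha>"
      using uniform sub cons S conseq_in_Fm[OF S] unfolding uniform_logic_def by blast
    then show ?thesis using theory_closed[OF T] by blast
  qed
  then show "?T = W \<inter> Fm_over L (variables L - V)" using gen by blast
qed

lemma lindenbaum_uniform: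
  assumes "uniform_logic L S" "Fm L \<noteq> {}"
  shows "uniform_atlas L (fm_algebra L) (theories L S) (\<lambda>T. T)"
  unfolding uniform_atlas_def uniform_bundle_def
proof (intro conjI allI impI ballI)
  show "atlas L (fm_algebra L) (theories L S) (\<lambda>T. T)"
    by (rule lindenbaum_atlas[OF assms(2)])
  then show "matrix_bundle L (theories L S) (atlas_bundle (fm_algebra L) (\<lambda>T. T))"
    by (rule matrix_bundle_atlas)
next
  fix X Y :: "('v, 'c, 'f) fm set" and i j Zi Zj
  assume ij: "i \<in> theories L S" "j \<in> theories L S"
    and Z: "Zi \<in> sat_sets L (atlas_bundle (fm_algebra L) (\<lambda>T. T) i)"
      "Zj \<in> sat_sets L (atlas_bundle (fm_algebra L) (\<lambda>T. T) j)"
  have th: "Zi \<in> theories L S" "Zj \<in> theories L S"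
    using Z sat_sets_fm_algebra ij by (auto simp: atlas_bundle_def)
  show "\<exists>k\<in>theories L S. \<exists>Zk\<in>sat_sets L (atlas_bundle (fm_algebra L) (\<lambda>T. T) k).
      X \<subseteq> Zi \<and> Y \<subseteq> Zj \<and> Zj \<subset> Fm L \<longrightarrow>
        Zi \<inter> Fm_over L (variables L - vars_of Y) = Zk \<inter> Fm_over L (variables L - vars_of Y) \<and>
        Zj \<inter> Fm_over L (vars_of Y) \<subseteq> Zk"
  \<comment> \<open>If \<open>Zj\<close> is not proper, the implication under the quantifiers is
    vacuous and any available index and satisfied set serve as witnesses.\<close>
  proof (cases "Zj \<subset> Fm L")
    case True
    note W = theories_amalgamate[OF assms(1) th True, of "vars_of Y"]
    show ?thesis
      \<comment> \<open>The amalgam is both the index \<open>k\<close> and the satisfied set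
        \<open>Zk\<close>.\<close>
      using W(2,3) theory_in_sat_sets[OF W(1)] by (intro bexI[OF _ W(1)]) (auto simp: atlas_bundle_def)
  next
    case False
    then show ?thesis using ij Z by blast
  qed
qed

lemma uniform_logic_imp_uniform_atlas:
  assumes "uniform_logic L S"
  shows "\<exists>(A :: (('v, 'c, 'f) fm, 'c, 'f) algebra) (I :: ('v, 'c, 'f) fm set set) D.
    uniform_atlas L A I D \<and> S = atlas_conseq L A I D"
proof (cases "Fm L = {}")
  case True
  \<comment> \<open>The formula algebra is not an \<open>is_algebra\<close> here: its carrier is empty.\<close>
  let ?A = "\<lparr>carrier = UNIV, const_op = Const, conn_op = Conn\<rparr> :: (('v, 'c, 'f) fm, 'c, 'f) algebra"
  have A: "atlas L ?A {{}} (\<lambda>_. {})" by (simp add: atlas_def is_algebra_def)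
  \<comment> \<open>Without formulae no \<open>Zj\<close> is a proper subset of \<open>Fm L\<close>,
    so the uniformity condition is vacuous; likewise neither consequence relation below ever
    holds.\<close>
  moreover have "uniform_bundle L {{}} (atlas_bundle ?A (\<lambda>_. {}))"
    unfolding uniform_bundle_def using matrix_bundle_atlas[OF A] True by auto
  moreover have "S = atlas_conseq L ?A {{}} (\<lambda>_. {})"
    using conseq_in_Fm True
    by (intro ext) (auto simp: atlas_conseq_def family_conseq_def matrix_conseq_def)
  ultimately show ?thesis unfolding uniform_atlas_def by blast
next
  case False
  then show ?thesis using lindenbaum_uniform[OF assms] lindenbaum_conseq by blast
qed

end

section \<open>From uniform bundles to uniform logics, by way of satisfied sets\<close>

lemma conseq_iff_sat_sets:
  assumes "I \<noteq> {}"
  shows "family_conseq L I M X \<alpha> \<longleftrightarrow> X \<subseteq> Fm L \<and> \<alpha> \<in> Fm L \<and>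
    (\<forall>i\<in>I. \<forall>Z\<in>sat_sets L (M i). X \<subseteq> Z \<longrightarrow> \<alpha> \<in> Z)"
proof -
  have "matrix_conseq L (M i) X \<alpha> \<longleftrightarrow> X \<subseteq> Fm L \<and> \<alpha> \<in> Fm L \<and>
      (\<forall>Z\<in>sat_sets L (M i). X \<subseteq> Z \<longrightarrow> \<alpha> \<in> Z)" for i
  proof (cases "X \<subseteq> Fm L \<and> \<alpha> \<in> Fm L")
    case True
    have sat: "sat_sets L (M i) =
        (\<lambda>v. {\<beta> \<in> Fm L. v \<beta> \<in> snd (M i)}) ` valuations L (fst (M i))"
      unfolding sat_sets_def by blast
    have "X \<subseteq> {\<beta> \<in> Fm L. v \<beta> \<in> snd (M i)} \<longleftrightarrow> v ` X \<subseteq> snd (M i)" for v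
      using True by blast
    then show ?thesis using True by (simp add: matrix_conseq_def sat)
  qed (auto simp: matrix_conseq_def)
  \<comment> \<open>Nonemptiness of \<open>I\<close> matters: over an empty family,
    \<open>family_conseq\<close> would hold even outside \<open>Fm L\<close>.\<close>
  then show ?thesis using assms by (auto simp: family_conseq_def)
qed

text \<open>Usable form of bundle uniformity: in the definition the implication sits below the
  existential quantifiers, so its premises are discharged only after the witnesses are
  chosen.\<close>

lemma uniform_bundle_amalgamate:
  assumes "uniform_bundle L I M" "X \<subseteq> Fm_over L (variables L - vars_of Y)" "Y \<subseteq> Fm L"
    and "i \<in> I" "Zi \<in> sat_sets L (M i)" "X \<subseteq> Zi"
    and "j \<in> I" "Zj \<in> sat_sets L (M j)" "Y \<subseteq> Zj" "Zj \<subset> Fm L"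
  obtains k Zk where "k \<in> I" "Zk \<in> sat_sets L (M k)"
    "Zi \<inter> Fm_over L (variables L - vars_of Y) = Zk \<inter> Fm_over L (variables L - vars_of Y)"
    "Zj \<inter> Fm_over L (vars_of Y) \<subseteq> Zk"
proof -
  have "X \<subseteq> Fm L" using assms(2) by (auto simp: Fm_over_def)
  from assms(1)[unfolded uniform_bundle_def, THEN conjunct2, rule_format,
      OF this assms(3,2,4,7,5,8)]
  show thesis using that assms(6,9,10) by (elim bexE) simp
qed

lemma uniform_bundle_imp_uniform_logic:
  assumes unif: "uniform_bundle L I M"
  shows "uniform_logic L (family_conseq L I M)"
  unfolding uniform_logic_def
proof (intro allI impI ballI)
  fix X Y :: "('a, 'b, 'c) fm set" and \<alpha>
  assume XY: "X \<subseteq> Fm L" "Y \<subseteq> Fm L" "\<alpha> \<in> Fm L"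
    and hyp: "vars_of (X \<union> {\<alpha>}) \<inter> vars_of Y = {} \<and> consistent L (family_conseq L I M) Y"
    and prem: "family_conseq L I M (X \<union> Y) \<alpha>"
  have I: "I \<noteq> {}" using unif by (simp add: uniform_bundle_def matrix_bundle_def)
  note sat = conseq_iff_sat_sets[OF I]
  have "Cn (family_conseq L I M) Y \<subset> Fm L"
    using hyp unfolding consistent_def by (auto simp: Cn_def sat)
  \<comment> \<open>Some formula does not follow from \<open>Y\<close>, so some satisfied set
    contains \<open>Y\<close> and misses that formula, which makes it proper.\<close>
  then obtain j Zj where j: "j \<in> I" "Zj \<in> sat_sets L (M j)" "Y \<subseteq> Zj" "Zj \<subset> Fm L"
    unfolding Cn_def using XY(2) by (auto simp: sat) (auto simp: sat_sets_def)
  let ?V = "vars_of Y"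
  \<comment> \<open>\<alpha> is included because agreement away from \<open>vars_of Y\<close> is
    used both ways: to carry \<open>X\<close> from \<open>Zi\<close> to \<open>Zk\<close> and
    \<alpha> back from \<open>Zk\<close> to \<open>Zi\<close>.\<close>
  have X: "X \<union> {\<alpha>} \<subseteq> Fm_over L (variables L - ?V)"
  proof
    fix \<beta>
    assume \<beta>: "\<beta> \<in> X \<union> {\<alpha>}"
    then have "\<beta> \<in> Fm L" using XY by blast
    moreover have "fm_vars \<beta> \<inter> ?V = {}"
      using hyp \<beta> unfolding vars_of_def[of "X \<union> {\<alpha>}"] by blast
    ultimately show "\<beta> \<in> Fm_over L (variables L - ?V)"
      using fm_vars_subset_variables[of \<beta> L] by (auto simp: Fm_over_def)
  qed
  have Y: "Y \<subseteq> Fm_over L ?V"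
    using XY(2) by (auto simp: Fm_over_def vars_of_def)
  have "\<alpha> \<in> Zi" if i: "i \<in> I" "Zi \<in> sat_sets L (M i)" "X \<subseteq> Zi" for i Zi
  proof -
    obtain k Zk where k: "k \<in> I" "Zk \<in> sat_sets L (M k)"
      and agree: "Zi \<inter> Fm_over L (variables L - ?V) = Zk \<inter> Fm_over L (variables L - ?V)"
        "Zj \<inter> Fm_over L ?V \<subseteq> Zk"
      using uniform_bundle_amalgamate[OF unif _ XY(2) i j] X by blast
    have "X \<union> Y \<subseteq> Zk" using agree X Y i(3) j(3) by blast
    then have "\<alpha> \<in> Zk" using prem k unfolding sat by blast
    then show ?thesis using agree X by blast
  qed
  then show "family_conseq L I M X \<alpha>" using XY sat by blast
qed

lemma uniform_atlas_imp_uniform_logic: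
  "uniform_atlas L A I D \<Longrightarrow> uniform_logic L (atlas_conseq L A I D)"
  unfolding uniform_atlas_def atlas_conseq_def using uniform_bundle_imp_uniform_logic by blast

theorem corollary2p2p1:
  fixes L :: "('v, 'c, 'f) language"
    and S :: "('v, 'c, 'f) conseq"
  assumes "structural_logic L S"
  shows
    "(uniform_logic L S \<longleftrightarrow>
       (\<exists>(I :: ('v, 'c, 'f) fm set set) (M :: ('v, 'c, 'f) fm set \<Rightarrow> (('v, 'c, 'f) fm, 'c, 'f) matrix).
          uniform_bundle L I M \<and> S = family_conseq L I M)) \<and>
     (uniform_logic L S \<longleftrightarrow>
       (\<exists>(A :: (('v, 'c, 'f) fm, 'c, 'f) algebra) (I :: ('v, 'c, 'f) fm set set)
          (D :: ('v, 'c, 'f) fm set \<Rightarrow> ('v, 'c, 'f) fm set).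
          uniform_atlas L A I D \<and> S = atlas_conseq L A I D)) \<and>
     (\<forall>(I :: 'i set) (M :: 'i \<Rightarrow> ('a, 'c, 'f) matrix).
        uniform_bundle L I M \<and> S = family_conseq L I M \<longrightarrow> uniform_logic L S) \<and>
     (\<forall>(A :: ('a, 'c, 'f) algebra) (I :: 'i set) (D :: 'i \<Rightarrow> 'a set).
        uniform_atlas L A I D \<and> S = atlas_conseq L A I D \<longrightarrow> uniform_logic L S)"
proof (intro conjI iffI allI impI)
  assume "uniform_logic L S"
  then show *: "\<exists>(A :: (('v, 'c, 'f) fm, 'c, 'f) algebra) (I :: ('v, 'c, 'f) fm set set)
      (D :: ('v, 'c, 'f) fm set \<Rightarrow> ('v, 'c, 'f) fm set).
      uniform_atlas L A I D \<and> S = atlas_conseq L A I D"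
    by (rule uniform_logic_imp_uniform_atlas[OF assms])
  \<comment> \<open>The bundle corresponding to the atlas is a witness by definition.\<close>
  then show "\<exists>(I :: ('v, 'c, 'f) fm set set)
      (M :: ('v, 'c, 'f) fm set \<Rightarrow> (('v, 'c, 'f) fm, 'c, 'f) matrix).
      uniform_bundle L I M \<and> S = family_conseq L I M"
    unfolding uniform_atlas_def atlas_conseq_def by blast
qed (auto dest: uniform_bundle_imp_uniform_logic uniform_atlas_imp_uniform_logic)

end
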